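(* Let $X=Y=\{0,1\}^{\mathbb{N}}$ with shift $\sigma$, let $c:X\times Y\to\mathbb{R}$ be a Lipschitz function, and let $$\alpha=\inf\left\{\int c\,d\pi:\ \pi\in\Pi(\sigma)\right\},$$ where $\Pi(\sigma)$ is the set of Borel probability measures on $X\times Y$ both of whose marginals are $\sigma$-invariant. Then there exist Lipschitz continuous functions $\varphi:X\to\mathbb{R}$ and $\psi:Y\to\mathbb{R}$ such that $$\alpha+\varphi(\sigma(x))-\varphi(x)+\psi(\sigma(y))-\psi(y)\le c(x,y)\qquad\text{for all }(x,y)\in X\times Y.$$
   Context: The shift is $\sigma(x_0,x_1,x_2,\dots)=(x_1,x_2,\dots)$. The space $\{0,1\}^{\mathbb{N}}$ carries the usual metric $d(x,x')=\lambda^{\min\{k:\,x_k\ne x'_k\}}$ for $x\neq x'$ and $d(x,x)=0$, with a fixed $\lambda\in(0,1)$ (for instance $\lambda=1/2$), and $X\times Y$ carries the sum of the two metrics. *)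

theory Defs
  imports "HOL-Probability.Probability"
begin

type_synonym binseq = "nat \<Rightarrow> bool"

definition shift :: "binseq \<Rightarrow> binseq" where
  "shift x = (\<lambda>n. x (Suc n))"

text \<open>The library already makes \<^typ>\<open>binseq\<close> an instance of \<^class>\<open>topological_space\<close>
  (product topology), but there is no instance giving the metric below, which depends on the
  parameter \<open>\<theta>\<close>. It is therefore a value of type \<^typ>\<open>binseq metric\<close>.\<close>

definition seq_dist :: "real \<Rightarrow> binseq \<Rightarrow> binseq \<Rightarrow> real" where
  "seq_dist \<theta> x y = (if x = y then 0 else \<theta> ^ (LEAST k. x k \<noteq> y k))"

definition seq_metric :: "real \<Rightarrow> binseq metric" where
  "seq_metric \<theta> = metric (UNIV, seq_dist \<theta>)"

text \<open>The library's \<^const>\<open>prod_metric\<close> is the Euclidean combination of the two metrics, hence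
  not the sum.\<close>

definition sum_metric :: "'a metric \<Rightarrow> 'b metric \<Rightarrow> ('a \<times> 'b) metric" where
  "sum_metric m1 m2 = metric (mspace m1 \<times> mspace m2,
     \<lambda>z w. mdist m1 (fst z) (fst w) + mdist m2 (snd z) (snd w))"

definition shift_invariant :: "binseq measure \<Rightarrow> bool" where
  "shift_invariant \<mu> \<longleftrightarrow> distr \<mu> borel shift = \<mu>"

definition shift_plans :: "(binseq \<times> binseq) measure set" where
  "shift_plans = {\<pi>. prob_space \<pi> \<and> sets \<pi> = sets borel \<and>
     shift_invariant (distr \<pi> borel fst) \<and> shift_invariant (distr \<pi> borel snd)}"

text \<open>For \<open>0 < \<theta> < 1\<close> both \<open>metric\<close> values above are genuine (the abstraction into
  type \<open>metric\<close> is not vacuous), and their topologies are the ones underlying \<^const>\<open>borel\<close>.\<close>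

lemma seq_dist_le_iff:
  assumes "0 < \<theta>" "\<theta> < 1"
  shows "seq_dist \<theta> x y \<le> \<theta> ^ n \<longleftrightarrow> (\<forall>k<n. x k = y k)"
proof (cases "x = y")
  case True
  then show ?thesis using assms by (simp add: seq_dist_def)
next
  case False
  then obtain j where j: "x j \<noteq> y j" by blast
  let ?l = "LEAST k. x k \<noteq> y k"
  have l: "x ?l \<noteq> y ?l" by (rule LeastI[of "\<lambda>k. x k \<noteq> y k", OF j])
  have "seq_dist \<theta> x y \<le> \<theta> ^ n \<longleftrightarrow> n \<le> ?l"
    using False assms by (simp add: seq_dist_def power_decreasing_iff)
  also have "\<dots> \<longleftrightarrow> (\<forall>k<n. x k = y k)"
    using l not_less_Least[of _ "\<lambda>k. x k \<noteq> y k"] by (meson le_less_trans less_le_trans not_le)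
  finally show ?thesis .
qed

lemma Metric_space_seq_dist:
  assumes "0 < \<theta>" "\<theta> < 1"
  shows "Metric_space UNIV (seq_dist \<theta>)"
proof
  show nn: "0 \<le> seq_dist \<theta> x y" for x y
    using assms by (simp add: seq_dist_def)
  show "seq_dist \<theta> x y = seq_dist \<theta> y x" for x y
    by (simp add: seq_dist_def eq_commute)
  show "seq_dist \<theta> x y = 0 \<longleftrightarrow> x = y" for x y
    using assms by (simp add: seq_dist_def)
  show "seq_dist \<theta> x z \<le> seq_dist \<theta> x y + seq_dist \<theta> y z" for x y z
  proof (cases "x = y \<or> y = z")
    case True
    then show ?thesis using nn by (auto simp: seq_dist_def)
  next
    case False
    define n m where "n = (LEAST k. x k \<noteq> y k)" and "m = (LEAST k. y k \<noteq> z k)"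
    have eq: "seq_dist \<theta> x y = \<theta> ^ n" "seq_dist \<theta> y z = \<theta> ^ m"
      using False by (auto simp: seq_dist_def n_def m_def)
    have "\<forall>k<n. x k = y k" "\<forall>k<m. y k = z k"
      using eq assms by (simp_all flip: seq_dist_le_iff)
    then have "seq_dist \<theta> x z \<le> \<theta> ^ min n m"
      using assms by (simp add: seq_dist_le_iff)
    also have "\<dots> \<le> \<theta> ^ n + \<theta> ^ m"
      using assms by (simp add: min_def)
    finally show ?thesis by (simp add: eq)
  qed
qed

lemma
  assumes "0 < \<theta>" "\<theta> < 1"
  shows mspace_seq_metric: "mspace (seq_metric \<theta>) = UNIV"
    and mdist_seq_metric: "mdist (seq_metric \<theta>) = seq_dist \<theta>"
  using Metric_space_seq_dist[OF assms]
  by (simp_all add: seq_metric_def Metric_space.mspace_metric Metric_space.mdist_metric)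

lemma Metric_space_sum:
  "Metric_space (mspace m1 \<times> mspace m2)
     (\<lambda>z w. mdist m1 (fst z) (fst w) + mdist m2 (snd z) (snd w))"
proof
  fix x y z
  assume xyz: "x \<in> mspace m1 \<times> mspace m2" "y \<in> mspace m1 \<times> mspace m2" "z \<in> mspace m1 \<times> mspace m2"
  show "mdist m1 (fst x) (fst z) + mdist m2 (snd x) (snd z) \<le>
        mdist m1 (fst x) (fst y) + mdist m2 (snd x) (snd y) +
        (mdist m1 (fst y) (fst z) + mdist m2 (snd y) (snd z))"
    using xyz mdist_triangle[of "fst x" m1 "fst y" "fst z"] mdist_triangle[of "snd x" m2 "snd y" "snd z"]
    by (auto simp: mem_Times_iff)
next
  fix x y
  assume "x \<in> mspace m1 \<times> mspace m2" "y \<in> mspace m1 \<times> mspace m2"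
  then show "mdist m1 (fst x) (fst y) + mdist m2 (snd x) (snd y) = 0 \<longleftrightarrow> x = y"
    by (auto simp: mem_Times_iff add_nonneg_eq_0_iff prod_eq_iff)
qed (simp_all add: mdist_commute)

lemma mspace_sum_metric [simp]: "mspace (sum_metric m1 m2) = mspace m1 \<times> mspace m2"
  and mdist_sum_metric [simp]: "mdist (sum_metric m1 m2) =
    (\<lambda>z w. mdist m1 (fst z) (fst w) + mdist m2 (snd z) (snd w))"
  using Metric_space_sum[of m1 m2]
  by (simp_all add: sum_metric_def Metric_space.mspace_metric Metric_space.mdist_metric)

lemma mtopology_of_seq_metric:
  assumes "0 < \<theta>" "\<theta> < 1"
  shows "mtopology_of (seq_metric \<theta>) = euclidean"
proof -
  interpret Metric_space UNIV "seq_dist \<theta>" by (rule Metric_space_seq_dist[OF assms])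
  have "openin mtopology U \<longleftrightarrow> open U" for U
  proof
    assume U: "openin mtopology U"
    have "\<exists>T. open T \<and> x \<in> T \<and> T \<subseteq> U" if x: "x \<in> U" for x
    proof -
      obtain r where r: "r > 0" "mball x r \<subseteq> U" using U x unfolding openin_mtopology by blast
      obtain n where n: "\<theta> ^ n < r" using real_arch_pow_inv[OF r(1) assms(2)] by blast
      have "open {y. \<forall>k\<in>{..<n}. y k \<in> {x k}}"
        by (rule product_topology_basis'[of "{..<n}" "\<lambda>k. {x k}" "\<lambda>k. k"]) (simp_all add: Topological_Spaces.open_discrete)
      moreover have "{y. \<forall>k\<in>{..<n}. y k \<in> {x k}} \<subseteq> mball x r"
      proof
        fix y assume "y \<in> {y. \<forall>k\<in>{..<n}. y k \<in> {x k}}"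
        then have "seq_dist \<theta> x y \<le> \<theta> ^ n" using assms by (simp add: seq_dist_le_iff)
        then show "y \<in> mball x r" using n by simp
      qed
      ultimately show ?thesis using r(2) by (intro exI[of _ "{y. \<forall>k\<in>{..<n}. y k \<in> {x k}}"]) auto
    qed
    then show "open U" by (subst open_subopen) blast
  next
    assume "open U"
    show "openin mtopology U" unfolding openin_mtopology
    proof (intro conjI allI impI)
      fix x assume "x \<in> U"
      then obtain X where X: "x \<in> (\<Pi>\<^sub>E i\<in>UNIV. X i)" "finite {i. X i \<noteq> UNIV}" "(\<Pi>\<^sub>E i\<in>UNIV. X i) \<subseteq> U"
        using \<open>open U\<close> product_topology_open_contains_basis[of "\<lambda>_. euclidean" UNIV U x]
        unfolding open_fun_def by auto
      obtain n where n: "\<And>i. X i \<noteq> UNIV \<Longrightarrow> i < n"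
        using X(2) unfolding finite_nat_set_iff_bounded by blast
      have "mball x (\<theta> ^ n) \<subseteq> U"
      proof
        fix y assume "y \<in> mball x (\<theta> ^ n)"
        then have *: "\<forall>k<n. x k = y k" using assms by (simp flip: seq_dist_le_iff)
        have "y i \<in> X i" for i
        proof (cases "i < n")
          case True
          then have "y i = x i" using * by simp
          then show ?thesis using X(1) by (simp add: PiE_iff)
        next
          case False
          then show ?thesis using n[of i] by auto
        qed
        then show "y \<in> U" using X(3) by (auto simp: PiE_iff)
      qed
      then show "\<exists>r>0. mball x r \<subseteq> U" using assms by (intro exI[of _ "\<theta> ^ n"]) simp
    qed simp
  qed
  then show ?thesis
    by (simp add: seq_metric_def topology_eq)
qed

lemma mtopology_of_sum_metric:
  "mtopology_of (sum_metric m1 m2) = prod_topology (mtopology_of m1) (mtopology_of m2)"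
proof -
  interpret E: Metric_space "mspace m1 \<times> mspace m2" "mdist (prod_metric m1 m2)"
    by (metis Metric_space_mspace_mdist mspace_prod_metric)
  interpret S: Metric_space "mspace m1 \<times> mspace m2" "mdist (sum_metric m1 m2)"
    by (metis Metric_space_mspace_mdist mspace_sum_metric)
  have le: "mdist (prod_metric m1 m2) z w \<le> mdist (sum_metric m1 m2) z w" for z w
    by (simp add: prod_dist_def case_prod_beta sqrt_sum_squares_le_sum)
  have ge: "mdist (sum_metric m1 m2) z w \<le> 2 * mdist (prod_metric m1 m2) z w" for z w
    using real_sqrt_sum_squares_ge1[of "mdist m1 (fst z) (fst w)" "mdist m2 (snd z) (snd w)"]
      real_sqrt_sum_squares_ge2[where x = "mdist m1 (fst z) (fst w)" and y = "mdist m2 (snd z) (snd w)"]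
    by (simp only: mdist_sum_metric mdist_prod_metric prod_dist_def case_prod_beta)
  have "openin E.mtopology U \<longleftrightarrow> openin S.mtopology U" for U
    unfolding E.openin_mtopology S.openin_mtopology
  proof (intro conj_cong refl all_cong1 imp_cong iffI; elim exE conjE)
    fix x r assume "0 < r" "E.mball x r \<subseteq> U"
    moreover have "S.mball x r \<subseteq> E.mball x r"
      using le le_less_trans unfolding S.mball_def E.mball_def by blast
    ultimately show "\<exists>r>0. S.mball x r \<subseteq> U" by blast
  next
    fix x r assume "0 < r" "S.mball x r \<subseteq> U"
    moreover have "mdist (sum_metric m1 m2) x y < r" if "mdist (prod_metric m1 m2) x y < r / 2" for y
      using ge[of x y] that by linarith
    then have "E.mball x (r / 2) \<subseteq> S.mball x r"
      unfolding S.mball_def E.mball_def by blast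
    ultimately show "\<exists>r>0. E.mball x r \<subseteq> U" by (intro exI[of _ "r / 2"]) auto
  qed
  then have "mtopology_of (sum_metric m1 m2) = mtopology_of (prod_metric m1 m2)"
    by (simp add: mtopology_of_def topology_eq)
  then show ?thesis by simp
qed

corollary mtopology_of_sum_seq_metric:
  assumes "0 < \<theta>" "\<theta> < 1"
  shows "mtopology_of (sum_metric (seq_metric \<theta>) (seq_metric \<theta>)) = euclidean"
  by (simp add: mtopology_of_sum_metric mtopology_of_seq_metric[OF assms])

end

theory Submission
  imports Defs
begin

text \<open>It suffices to find Lipschitz \<open>f\<close>, \<open>g\<close> with \<open>f x + g y \<le> c (x, y) - \<alpha>\<close> whose Birkhoff sums
  over periodic orbits are nonnegative: such a function dominates a Lipschitz coboundary.
  On the finite set \<open>P\<close> of points of period \<open>N\<close>, weights on \<open>P \<times> P\<close> with invariant marginals are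
  plans, hence have cost at least \<open>\<alpha>\<close>, and finite linear programming duality (up to an
  error \<open>\<epsilon>\<close>) gives potentials \<open>\<phi>\<close>, \<open>\<psi>\<close> on \<open>P\<close>. Then
  \<open>f x = min\<^bsub>y \<in> P\<^esub> (c (x, y) - \<alpha> + \<epsilon> + \<psi> y - \<psi> (shift y))\<close> is defined for all \<open>x\<close> and
  inherits the Lipschitz constant of \<open>c\<close>, so the functions \<open>f\<close> lie in a compact set independent of
  \<open>N\<close> and \<open>\<epsilon>\<close>. Letting \<open>N = n!\<close> grow and \<open>\<epsilon> \<rightarrow> 0\<close>, a limit \<open>f\<close> works for all periods, and
  \<open>g y = inf\<^bsub>x\<^esub> (c (x, y) - \<alpha> - f x)\<close>.\<close>

section \<open>Compactness for pointwise convergence\<close>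

text \<open>Tychonoff. The index type is arbitrary: it serves both the weights on a finite set and
  the functions on all of \<open>binseq\<close>.\<close>

lemma compact_box_fun:
  fixes a b :: "'i \<Rightarrow> real"
  shows "compact {f. \<forall>i. f i \<in> {a i..b i}}"
proof -
  have "compactin (product_topology (\<lambda>_. euclidean) UNIV) (PiE UNIV (\<lambda>i. {a i..b i}))"
    by (subst compactin_PiE) simp
  moreover have "PiE UNIV (\<lambda>i. {a i..b i}) = {f. \<forall>i. f i \<in> {a i..b i}}"
    by (auto simp: PiE_iff)
  ultimately show ?thesis
    by (simp add: euclidean_product_topology)
qed

text \<open>Finite intersection property: finitely many members of the family all contain one with a
  larger index, and that one meets \<open>K\<close>.\<close>

lemma compact_decreasing_Inter:
  fixes F :: "nat \<Rightarrow> 'a::topological_space set"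
  assumes K: "compact K" and cl: "\<And>n. closed (F n)" and ne: "\<And>n. K \<inter> F n \<noteq> {}"
    and dec: "\<And>m n. m \<le> n \<Longrightarrow> F n \<subseteq> F m"
  obtains x where "x \<in> K" "\<And>n. x \<in> F n"
proof -
  have "K \<inter> (\<Inter>n\<in>UNIV. F n) \<noteq> {}"
  proof (rule compact_imp_fip_image[OF K cl])
    fix I :: "nat set" assume "finite I"
    then obtain m where "\<And>n. n \<in> I \<Longrightarrow> n \<le> m"
      unfolding finite_nat_set_iff_bounded_le by blast
    then have "F m \<subseteq> (\<Inter>n\<in>I. F n)" using dec by blast
    then show "K \<inter> (\<Inter>n\<in>I. F n) \<noteq> {}" using ne[of m] by blast
  qed
  then show ?thesis using that by blast
qed

section \<open>Finite linear programming duality\<close>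

text \<open>First-order condition at a minimum, without derivatives: divide by \<open>t\<close> and
  let \<open>t\<close> tend to 0.\<close>

lemma linear_coeff_nonneg:
  fixes b d :: real
  assumes "\<And>t. 0 < t \<Longrightarrow> t \<le> 1 \<Longrightarrow> 0 \<le> t * b + t\<^sup>2 * d"
  shows "0 \<le> b"
proof (rule ccontr)
  assume "\<not> 0 \<le> b"
  \<comment> \<open>Small enough that \<open>t * d\<close> is at most
    \<open>- b / 2\<close>.\<close>
  define t where "t = min 1 (- b / (2 * (\<bar>d\<bar> + 1)))"
  have t: "0 < t" "t \<le> 1" using \<open>\<not> 0 \<le> b\<close> by (auto simp: t_def divide_neg_pos)
  have "t * (2 * (\<bar>d\<bar> + 1)) \<le> - b"
    using pos_le_divide_eq[of "2 * (\<bar>d\<bar> + 1)" t "- b"] by (simp add: t_def)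
  moreover have "t * d \<le> t * (\<bar>d\<bar> + 1)" using t by (intro mult_left_mono) auto
  ultimately have "b + t * d < 0" using \<open>\<not> 0 \<le> b\<close> by linarith
  then have "t * (b + t * d) < 0" using t by (simp add: mult_pos_neg)
  then show False using assms[OF t] by (simp add: power2_eq_square algebra_simps)
qed

text \<open>Minimise \<open>\<Sum>w k + n (\<Sum>j (\<Sum>w (h j))\<^sup>2)\<close> over the simplex. By compactness the minimum is
  positive for large \<open>n\<close>, and stationarity in the directions of the vertices shows that
  \<open>2 n \<Sum>w (h j)\<close> are suitable multipliers.\<close>

lemma simplex_multipliers:
  fixes k :: "'z \<Rightarrow> real" and h :: "'j \<Rightarrow> 'z \<Rightarrow> real"
  assumes Z: "finite Z" "Z \<noteq> {}"
    and pos: "\<And>w. (\<And>z. 0 \<le> w z) \<Longrightarrow> (\<And>z. z \<notin> Z \<Longrightarrow> w z = 0) \<Longrightarrow> (\<Sum>z\<in>Z. w z) = 1 \<Longrightarrow>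
      (\<And>j. j \<in> J \<Longrightarrow> (\<Sum>z\<in>Z. w z * h j z) = 0) \<Longrightarrow> 0 < (\<Sum>z\<in>Z. w z * k z)"
    and J: "finite J"
  obtains l where "\<And>z. z \<in> Z \<Longrightarrow> 0 < k z + (\<Sum>j\<in>J. l j * h j z)"
proof -
  define E where "E g w = (\<Sum>z\<in>Z. w z * g z)" for g w :: "'z \<Rightarrow> real"
  define Q where "Q w = (\<Sum>j\<in>J. (E (h j) w)\<^sup>2)" for w
  define V where "V n w = E k w + real n * Q w" for n w
  \<comment> \<open>The box is \<open>{0..0}\<close> outside \<open>Z\<close>, so this is the
    simplex over \<open>Z\<close>, compact as a set of functions on the whole type.\<close>
  define W where "W = {w. \<forall>z. w z \<in> {0..if z \<in> Z then 1 else 0}} \<inter> {w. (\<Sum>z\<in>Z. w z) = (1::real)}"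
  have contE: "continuous_on S (E g)" for g S
    unfolding E_def
    by (intro continuous_intros continuous_on_subset[OF continuous_on_product_coordinates]) simp
  have contV: "continuous_on S (V n)" for n S
    unfolding V_def Q_def by (intro continuous_intros contE)
  have W: "compact W" unfolding W_def
    by (intro compact_Int_closed compact_box_fun closed_Collect_eq continuous_intros
        continuous_on_product_coordinates)
  have WI: "w \<in> W" if "\<And>z. 0 \<le> w z" "\<And>z. z \<notin> Z \<Longrightarrow> w z = 0" "(\<Sum>z\<in>Z. w z) = 1" for w
  proof -
    have "w z \<le> 1" if "z \<in> Z" for z
      using member_le_sum[of z Z w] that \<open>\<And>z. 0 \<le> w z\<close> \<open>(\<Sum>z\<in>Z. w z) = 1\<close> Z by simp
    then show ?thesis using that by (auto simp: W_def)
  qed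
  have WD: "0 \<le> w z" "z \<notin> Z \<Longrightarrow> w z = 0" "(\<Sum>z\<in>Z. w z) = 1" if "w \<in> W" for w z
    using that by (auto simp: W_def dest!: spec[of _ z] split: if_splits)
  have Wne: "W \<noteq> {}"
  proof -
    obtain z0 where "z0 \<in> Z" using Z by blast
    then have "(\<lambda>z. if z = z0 then 1 else 0) \<in> W" using Z by (intro WI) auto
    then show ?thesis by blast
  qed
  have Q0: "0 \<le> Q w" for w by (simp add: Q_def sum_nonneg)
  \<comment> \<open>Otherwise the decreasing sets \<open>V n w \<le> 0\<close> share a point
    \<open>w\<close>. There \<open>n * Q w\<close> is bounded in \<open>n\<close>, so
    \<open>Q w = 0\<close>: all constraints hold at \<open>w\<close>, contradicting
    \<open>pos\<close>.\<close>
  have "\<exists>n. \<forall>w\<in>W. 0 < V n w"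
  proof (rule ccontr)
    assume "\<not> ?thesis"
    then have ne: "W \<inter> {w. V n w \<le> 0} \<noteq> {}" for n by (force simp: not_less)
    have dec: "{w. V n w \<le> 0} \<subseteq> {w. V m w \<le> 0}" if "m \<le> n" for m n
    proof clarify
      fix w assume "V n w \<le> 0"
      moreover have "real m * Q w \<le> real n * Q w" using that Q0 by (intro mult_right_mono) auto
      ultimately show "V m w \<le> 0" by (simp add: V_def)
    qed
    obtain w where w: "w \<in> W" "\<And>n. w \<in> {w. V n w \<le> 0}"
      by (rule compact_decreasing_Inter[OF W _ ne dec])
        (auto intro!: closed_Collect_le contV continuous_intros)
    have le: "real n * Q w \<le> - E k w" for n using w(2)[of n] by (simp add: V_def)
    have "Q w = 0"
    proof (rule ccontr)
      assume "Q w \<noteq> 0"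
      then have "0 < Q w" using Q0[of w] by simp
      then obtain n where "- E k w < real n * Q w" using reals_Archimedean3 by blast
      then show False using le[of n] by simp
    qed
    then have "E (h j) w = 0" if "j \<in> J" for j
      using that J by (simp add: Q_def sum_nonneg_eq_0_iff)
    then have "0 < E k w" using WD[OF w(1)] unfolding E_def by (intro pos) auto
    then show False using le[of 0] by simp
  qed
  then obtain n where n: "\<And>w. w \<in> W \<Longrightarrow> 0 < V n w" by blast
  obtain w where w: "w \<in> W" "\<And>u. u \<in> W \<Longrightarrow> V n w \<le> V n u"
    using continuous_attains_inf[OF W Wne contV[of W n]] by blast
  show ?thesis
  proof (rule that)
    fix z0 assume z0: "z0 \<in> Z"
    have "0 \<le> (k z0 - E k w) + real n * (\<Sum>j\<in>J. 2 * E (h j) w * (h j z0 - E (h j) w))"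
    proof (rule linear_coeff_nonneg)
      fix t :: real assume t: "0 < t" "t \<le> 1"
      \<comment> \<open>The minimiser \<open>w\<close> moved by \<open>t\<close> towards the vertex
        \<open>z0\<close>; on this segment \<open>V n\<close> is quadratic in
        \<open>t\<close>.\<close>
      define u where "u z = (1 - t) * w z + (if z = z0 then t else 0)" for z
      have Eu: "E g u = E g w + t * (g z0 - E g w)" for g
      proof -
        have "E g u = (\<Sum>z\<in>Z. (1 - t) * (w z * g z) + (if z = z0 then t * g z else 0))"
          unfolding E_def u_def by (intro sum.cong) (auto simp: algebra_simps)
        also have "\<dots> = (1 - t) * E g w + t * g z0"
          using Z z0 by (simp add: sum.distrib E_def sum_distrib_left)
        finally show ?thesis by (simp add: algebra_simps)
      qed
      have "u \<in> W"
      proof (rule WI)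
        show "0 \<le> u z" for z using t WD(1)[OF w(1)] by (simp add: u_def)
        show "u z = 0" if "z \<notin> Z" for z using that z0 WD(2)[OF w(1)] by (auto simp: u_def)
        show "(\<Sum>z\<in>Z. u z) = 1"
          using Eu[of "\<lambda>_. 1"] WD(3)[OF w(1)] by (simp add: E_def)
      qed
      then have "0 \<le> V n u - V n w" using w(2) by simp
      also have "Q u = Q w + t * (\<Sum>j\<in>J. 2 * E (h j) w * (h j z0 - E (h j) w))
          + t\<^sup>2 * (\<Sum>j\<in>J. (h j z0 - E (h j) w)\<^sup>2)"
        unfolding Q_def Eu sum_distrib_left
        by (simp add: power2_eq_square algebra_simps flip: sum.distrib)
      then have "V n u - V n w = t * ((k z0 - E k w) + real n * (\<Sum>j\<in>J. 2 * E (h j) w * (h j z0 - E (h j) w)))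
          + t\<^sup>2 * (real n * (\<Sum>j\<in>J. (h j z0 - E (h j) w)\<^sup>2))"
        by (simp add: V_def Eu algebra_simps)
      finally show "0 \<le> t * ((k z0 - E k w) + real n * (\<Sum>j\<in>J. 2 * E (h j) w * (h j z0 - E (h j) w)))
          + t\<^sup>2 * (real n * (\<Sum>j\<in>J. (h j z0 - E (h j) w)\<^sup>2))" .
    qed
    also have "(\<Sum>j\<in>J. 2 * E (h j) w * (h j z0 - E (h j) w))
        = (\<Sum>j\<in>J. 2 * E (h j) w * h j z0) - 2 * Q w"
      by (simp add: Q_def sum_distrib_left power2_eq_square algebra_simps sum_subtractf)
    \<comment> \<open>The left side is \<open>V n w + n * Q w\<close>, hence positive.\<close>
    finally have "E k w + 2 * (real n * Q w) \<le> k z0 + real n * (\<Sum>j\<in>J. 2 * E (h j) w * h j z0)"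
      by (simp add: algebra_simps)
    moreover have "0 < V n w" using n w(1) by blast
    moreover have "0 \<le> real n * Q w" using Q0 by simp
    ultimately show "0 < k z0 + (\<Sum>j\<in>J. (real n * (2 * E (h j) w)) * h j z0)"
      by (simp add: V_def sum_distrib_left mult.assoc)
  qed
qed

section \<open>Birkhoff sums and Lipschitz coboundaries\<close>

lemma shift_funpow: "(shift ^^ j) x = (\<lambda>i. x (i + j))"
  by (induction j) (auto simp: shift_def)

text \<open>Backward contraction: if the \<open>k\<close>-th shifts agree on \<open>n\<close>
  symbols, then the \<open>j\<close>-th shifts agree on \<open>k - j + n\<close>.\<close>

lemma seq_dist_funpow_shift:
  assumes \<theta>: "0 < \<theta>" "\<theta> < 1" and j: "j \<le> k"
    and eq: "\<And>i. i < k \<Longrightarrow> u i = v i"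
  shows "seq_dist \<theta> ((shift ^^ j) u) ((shift ^^ j) v)
    \<le> \<theta> ^ (k - j) * seq_dist \<theta> ((shift ^^ k) u) ((shift ^^ k) v)"
proof (cases "(shift ^^ k) u = (shift ^^ k) v")
  case True
  have "u i = v i" for i
    using eq[of i] fun_cong[OF True, of "i - k"] by (cases "i < k") (auto simp: shift_funpow)
  then have "u = v" by blast
  then show ?thesis by (simp add: seq_dist_def)
next
  case False
  define n where "n = (LEAST i. (shift ^^ k) u i \<noteq> (shift ^^ k) v i)"
  have n: "seq_dist \<theta> ((shift ^^ k) u) ((shift ^^ k) v) = \<theta> ^ n"
    using False by (simp add: seq_dist_def n_def)
  then have "\<forall>i<n. (shift ^^ k) u i = (shift ^^ k) v i" using \<theta> by (simp flip: seq_dist_le_iff)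
  then have *: "u i = v i" if "i < n + k" for i
    using that eq[of i] by (cases "i < k") (auto simp: shift_funpow dest!: spec[of _ "i - k"])
  have "seq_dist \<theta> ((shift ^^ j) u) ((shift ^^ j) v) \<le> \<theta> ^ (k - j + n)"
    using \<theta> j by (subst seq_dist_le_iff) (auto simp: shift_funpow intro!: *)
  then show ?thesis by (simp add: n power_add)
qed

lemma seq_dist_nonneg: "0 \<le> \<theta> \<Longrightarrow> 0 \<le> seq_dist \<theta> x y"
  by (simp add: seq_dist_def)

lemma seq_dist_le_1: "0 < \<theta> \<Longrightarrow> \<theta> < 1 \<Longrightarrow> seq_dist \<theta> x y \<le> 1"
  using seq_dist_le_iff[of \<theta> x y 0] by simp

lemma seq_dist_commute: "seq_dist \<theta> x y = seq_dist \<theta> y x"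
  by (simp add: seq_dist_def eq_commute)

definition birkhoff_sum :: "(binseq \<Rightarrow> real) \<Rightarrow> nat \<Rightarrow> binseq \<Rightarrow> real" where
  "birkhoff_sum f k x = (\<Sum>j<k. f ((shift ^^ j) x))"

text \<open>Bounded distortion: term \<open>j\<close> contributes at most
  \<open>L * \<theta> ^ (k - j)\<close> times the final distance, and the geometric series gives a
  constant independent of \<open>k\<close>.\<close>

lemma birkhoff_sum_diff_le:
  assumes \<theta>: "0 < \<theta>" "\<theta> < 1" and L: "0 \<le> L"
    and f: "\<And>x y. f x - f y \<le> L * seq_dist \<theta> x y"
    and eq: "\<And>i. i < k \<Longrightarrow> u i = v i"
  shows "birkhoff_sum f k u - birkhoff_sum f k v
    \<le> L / (1 - \<theta>) * seq_dist \<theta> ((shift ^^ k) u) ((shift ^^ k) v)"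
proof -
  let ?d = "seq_dist \<theta> ((shift ^^ k) u) ((shift ^^ k) v)"
  have d: "0 \<le> ?d" using \<theta> by (simp add: seq_dist_nonneg)
  have "birkhoff_sum f k u - birkhoff_sum f k v
      = (\<Sum>j<k. f ((shift ^^ j) u) - f ((shift ^^ j) v))"
    by (simp add: birkhoff_sum_def sum_subtractf)
  also have "\<dots> \<le> (\<Sum>j<k. L * (\<theta> ^ (k - j) * ?d))"
    using seq_dist_funpow_shift[OF \<theta>, of _ k u v] eq L
    by (intro sum_mono order.trans[OF f] mult_left_mono) auto
  also have "\<dots> = L * (\<Sum>j<k. \<theta> ^ (k - j)) * ?d"
    by (simp add: sum_distrib_left sum_distrib_right mult.assoc)
  also have "(\<Sum>j<k. \<theta> ^ (k - j)) = (\<Sum>j<k. \<theta> ^ Suc j)"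
    using sum.nat_diff_reindex[of "\<lambda>j. \<theta> ^ Suc j" k] by (simp add: Suc_diff_Suc)
  also have "L * (\<Sum>j<k. \<theta> ^ Suc j) * ?d \<le> L * (1 / (1 - \<theta>)) * ?d"
  proof (intro mult_right_mono mult_left_mono d L)
    have "(\<Sum>j<k. \<theta> ^ Suc j) \<le> (\<Sum>j<k. \<theta> ^ j)"
      using \<theta> by (intro sum_mono power_decreasing) auto
    also have "\<dots> = (1 - \<theta> ^ k) / (1 - \<theta>)" using \<theta> sum_gp_strict[of \<theta> k] by simp
    also have "\<dots> \<le> 1 / (1 - \<theta>)" using \<theta> by (intro divide_right_mono) auto
    finally show "(\<Sum>j<k. \<theta> ^ Suc j) \<le> 1 / (1 - \<theta>)" .
  qed
  finally show ?thesis by simp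
qed

text \<open>Replacing the first \<open>k\<close> symbols by a periodic repetition of them changes a Birkhoff sum of
  length \<open>k\<close> by a bounded amount, so nonnegativity on periodic orbits bounds all Birkhoff sums from
  below. The transfer function is then the infimum of the Birkhoff sums along all finite backward
  orbits of the point.\<close>

lemma Lipschitz_coboundary_le:
  assumes \<theta>: "0 < \<theta>" "\<theta> < 1" and L: "0 \<le> L"
    and f: "\<And>x y. f x - f y \<le> L * seq_dist \<theta> x y"
    and per: "\<And>k x. 0 < k \<Longrightarrow> (shift ^^ k) x = x \<Longrightarrow> 0 \<le> birkhoff_sum f k x"
  obtains \<phi> where "Lipschitz_continuous_map (seq_metric \<theta>) euclidean_metric \<phi>"
    "\<And>x. \<phi> (shift x) - \<phi> x \<le> f x"
proof -
  define C where "C = L / (1 - \<theta>)"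
  have C: "0 \<le> C" using L \<theta> by (simp add: C_def)
  have diff: "birkhoff_sum f k u - birkhoff_sum f k v
      \<le> C * seq_dist \<theta> ((shift ^^ k) u) ((shift ^^ k) v)" if "\<And>i. i < k \<Longrightarrow> u i = v i" for k u v
    unfolding C_def by (rule birkhoff_sum_diff_le[OF \<theta> L f that])
  have lower: "- C \<le> birkhoff_sum f k u" for k u
  proof (cases "k = 0")
    case True
    then show ?thesis using C by (simp add: birkhoff_sum_def)
  next
    case False
    define p where "p = (\<lambda>i. u (i mod k))"
    have "0 \<le> birkhoff_sum f k p" using False by (intro per) (auto simp: p_def shift_funpow)
    moreover have "birkhoff_sum f k p - birkhoff_sum f k u \<le> C * 1"
      using \<theta> C by (intro order.trans[OF diff] mult_left_mono seq_dist_le_1) (auto simp: p_def)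
    ultimately show ?thesis by simp
  qed
  \<comment> \<open>\<open>cat (w, k) x\<close> puts the first \<open>k\<close> symbols of
    \<open>w\<close> in front of \<open>x\<close>, so the pairs \<open>(w, k)\<close> index the
    finite backward orbits of \<open>x\<close>.\<close>
  define cat :: "binseq \<times> nat \<Rightarrow> binseq \<Rightarrow> binseq"
    where "cat = (\<lambda>(w, k) x i. if i < k then w i else x (i - k))"
  have cat: "(shift ^^ k) (cat (w, k) x) = x" for w k x
    by (simp add: shift_funpow cat_def)
  define S where "S p x = birkhoff_sum f (snd p) (cat p x)" for p x
  define \<phi> where "\<phi> x = (INF p. S p x)" for x
  have bdd: "bdd_below (range (\<lambda>p. S p x))" for x
    using lower by (auto simp: S_def intro!: bdd_belowI2)
  \<comment> \<open>The two points share the prefix, so \<open>diff\<close> applies with a constant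
    independent of \<open>p\<close>, which survives the infimum.\<close>
  have S_diff: "S p x \<le> S p y + C * seq_dist \<theta> x y" for p x y
    using diff[of "snd p" "cat p x" "cat p y"] cat[of "snd p" "fst p"]
    by (auto simp: S_def cat_def case_prod_beta)
  have diff_le: "\<phi> x - \<phi> y \<le> C * seq_dist \<theta> x y" for x y
  proof -
    have "\<phi> x - C * seq_dist \<theta> x y \<le> \<phi> y"
      unfolding \<phi>_def[of y]
    proof (rule cINF_greatest)
      show "\<phi> x - C * seq_dist \<theta> x y \<le> S p y" for p
        using cINF_lower[OF bdd[of x], of p] S_diff[of p x y] by (simp add: \<phi>_def)
    qed simp
    then show ?thesis by simp
  qed
  show ?thesis
  proof (rule that)
    show "Lipschitz_continuous_map (seq_metric \<theta>) euclidean_metric \<phi>"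
      using diff_le seq_dist_commute[of \<theta>] unfolding Lipschitz_continuous_map_def
      by (auto simp: mdist_seq_metric[OF \<theta>] mspace_seq_metric[OF \<theta>] dist_real_def abs_le_iff
          intro!: exI[of _ C]) (metis)
    show "\<phi> (shift x) - \<phi> x \<le> f x" for x
    proof -
      have "\<phi> (shift x) - f x \<le> \<phi> x"
        unfolding \<phi>_def[of x]
      proof (rule cINF_greatest)
        fix p :: "binseq \<times> nat"
        obtain w k where p: "p = (w, k)" by force
        \<comment> \<open>The symbol \<open>x 0\<close> joins the prefix: a backward orbit of
          \<open>x\<close> becomes one of \<open>shift x\<close>, longer by the single term
          \<open>f x\<close>.\<close>
        have eq: "cat (cat (w, k) x, Suc k) (shift x) = cat (w, k) x"
          by (auto simp: cat_def shift_def fun_eq_iff Suc_diff_Suc not_less less_Suc_eq)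
        have "\<phi> (shift x) \<le> S (cat (w, k) x, Suc k) (shift x)"
          unfolding \<phi>_def by (rule cINF_lower[OF bdd]) simp
        also have "\<dots> = S p x + f x"
          by (simp add: S_def p eq birkhoff_sum_def cat)
        finally show "\<phi> (shift x) - f x \<le> S p x" by simp
      qed simp
      then show ?thesis by simp
    qed
  qed
qed

section \<open>Plans and potentials on finite shift-closed sets\<close>

lemma measurable_shift [measurable]: "shift \<in> borel_measurable borel"
proof -
  have "continuous_on UNIV shift"
    unfolding shift_def by (intro continuous_on_coordinatewise_then_product continuous_on_product_coordinates)
  then show ?thesis by (rule borel_measurable_continuous_onI)
qed

text \<open>Testing invariance at points of \<open>P\<close> suffices: both image distributions give
  no mass to points outside \<open>P\<close>.\<close>

lemma map_pmf_shift_invariant: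
  fixes w :: "'z \<Rightarrow> real"
  assumes Z: "finite Z" and p: "\<And>z. pmf p z = w z" and w: "\<And>z. z \<notin> Z \<Longrightarrow> w z = 0"
    and P: "g ` Z \<subseteq> P" "shift ` P \<subseteq> P"
    and inv: "\<And>x. x \<in> P \<Longrightarrow> (\<Sum>z\<in>Z. w z * (of_bool (shift (g z) = x) - of_bool (g z = x))) = 0"
  shows "map_pmf (shift \<circ> g) p = map_pmf g p"
proof (rule pmf_eqI)
  fix x
  have pmf: "pmf (map_pmf G p) x = (\<Sum>z\<in>Z. w z * of_bool (G z = x))" for G :: "'z \<Rightarrow> binseq"
  proof -
    have "pmf (map_pmf G p) x = (\<integral>z. indicator (G -` {x}) z \<partial>measure_pmf p)"
      by (simp add: pmf_map)
    also have "\<dots> = (\<Sum>z\<in>Z. indicator (G -` {x}) z * pmf p z)"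
      using w p by (intro integral_measure_pmf_real[OF Z]) (auto simp: set_pmf_iff)
    finally show ?thesis by (simp add: p indicator_def mult.commute)
  qed
  show "pmf (map_pmf (shift \<circ> g) p) x = pmf (map_pmf g p) x"
  proof (cases "x \<in> P")
    case True
    then show ?thesis using inv[of x] by (simp add: pmf right_diff_distrib sum_subtractf)
  next
    case False
    then have "shift (g z) \<noteq> x \<and> g z \<noteq> x" if "z \<in> Z" for z using P that by blast
    then show ?thesis by (simp add: pmf)
  qed
qed

text \<open>Feasible weights of the finite linear program are genuine plans of the same cost; this
  is where \<open>\<alpha>\<close> enters the finite problem.\<close>

lemma finite_shift_plan:
  fixes w :: "binseq \<times> binseq \<Rightarrow> real"
  assumes P: "finite P" "shift ` P \<subseteq> P"
    and w: "\<And>z. 0 \<le> w z" "\<And>z. z \<notin> P \<times> P \<Longrightarrow> w z = 0" "(\<Sum>z\<in>P \<times> P. w z) = 1"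
    and fst: "\<And>x. x \<in> P \<Longrightarrow> (\<Sum>z\<in>P \<times> P. w z * (of_bool (shift (fst z) = x) - of_bool (fst z = x))) = 0"
    and snd: "\<And>x. x \<in> P \<Longrightarrow> (\<Sum>z\<in>P \<times> P. w z * (of_bool (shift (snd z) = x) - of_bool (snd z = x))) = 0"
    and c: "c \<in> borel_measurable borel"
  obtains \<pi> where "\<pi> \<in> shift_plans" "integral\<^sup>L \<pi> c = (\<Sum>z\<in>P \<times> P. w z * c z)"
proof -
  have "(\<integral>\<^sup>+z. ennreal (w z) \<partial>count_space UNIV) = (\<Sum>z\<in>P \<times> P. ennreal (w z))"
    using P w by (intro nn_integral_count_space') auto
  also have "\<dots> = 1" using w by (simp add: sum_ennreal)
  finally have p: "pmf (embed_pmf w) z = w z" for z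
    using w(1) by (intro pmf_embed_pmf) auto
  define p where "p = embed_pmf w"
  note p = p[folded p_def]
  \<comment> \<open>A pmf measures all sets; \<open>distr\<close> along the identity restricts it to
    the Borel sets, as \<open>shift_plans\<close> demands.\<close>
  define \<pi> where "\<pi> = distr (measure_pmf p) borel (\<lambda>z. z)"
  have inv: "shift_invariant (distr \<pi> borel g)"
    if g: "g \<in> borel_measurable borel" and eq: "map_pmf (shift \<circ> g) p = map_pmf g p" for g
  proof -
    have *: "distr \<pi> borel G = distr (measure_pmf (map_pmf G p)) borel (\<lambda>z. z)"
      if "G \<in> borel_measurable borel" for G :: "_ \<Rightarrow> binseq"
      using that unfolding \<pi>_def map_pmf_rep_eq by (simp add: distr_distr comp_def)
    have "distr (distr \<pi> borel g) borel shift = distr \<pi> borel (shift \<circ> g)"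
      using g by (intro distr_distr) (auto simp: \<pi>_def)
    also have "\<dots> = distr \<pi> borel g"
      using g by (simp add: * eq measurable_comp[OF g measurable_shift])
    finally show ?thesis by (simp add: shift_invariant_def)
  qed
  have "\<pi> \<in> shift_plans" unfolding shift_plans_def
  proof (intro CollectI conjI inv map_pmf_shift_invariant[OF _ p w(2) _ P(2)])
    show "prob_space \<pi>" unfolding \<pi>_def by (intro measure_pmf.prob_space_distr) simp
  qed (use P fst snd in \<open>auto simp: \<pi>_def intro!: borel_measurable_continuous_onI continuous_on_fst[OF continuous_on_id]
      continuous_on_snd[OF continuous_on_id]\<close>)
  moreover have "integral\<^sup>L \<pi> c = (\<integral>z. c z \<partial>measure_pmf p)"
    unfolding \<pi>_def using c by (intro integral_distr) simp_all
  moreover have "z \<in> P \<times> P" if "z \<in> set_pmf p" for z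
    using that p w(2) by (metis set_pmf_iff)
  then have "(\<integral>z. c z \<partial>measure_pmf p) = (\<Sum>z\<in>P \<times> P. c z * pmf p z)"
    using P by (intro integral_measure_pmf_real) simp_all
  ultimately show ?thesis using that by (simp add: p mult.commute)
qed

text \<open>Each feasible weight costs at least \<open>a\<close>, so the slack
  \<open>\<epsilon>\<close> gives the strict positivity required by
  \<open>simplex_multipliers\<close>. The negated multipliers are the potentials.\<close>

lemma periodic_potentials:
  assumes P: "finite P" "P \<noteq> {}" "shift ` P \<subseteq> P" and c: "c \<in> borel_measurable borel"
    and a: "\<And>\<pi>. \<pi> \<in> shift_plans \<Longrightarrow> a \<le> integral\<^sup>L \<pi> c" and \<epsilon>: "0 < \<epsilon>"
  obtains \<phi> \<psi> :: "binseq \<Rightarrow> real" where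
    "\<And>x y. x \<in> P \<Longrightarrow> y \<in> P \<Longrightarrow> a + \<phi> (shift x) - \<phi> x + \<psi> (shift y) - \<psi> y \<le> c (x, y) + \<epsilon>"
proof -
  define d where "d p x = of_bool (shift x = p) - (of_bool (x = p) :: real)" for p x
  \<comment> \<open>One constraint per point of \<open>P\<close> and marginal: \<open>Inl\<close>
    for the first, \<open>Inr\<close> for the second.\<close>
  define h where "h = case_sum (\<lambda>p z. d p (fst z)) (\<lambda>p z. d p (snd z))"
  obtain l where l: "\<And>z. z \<in> P \<times> P \<Longrightarrow> 0 < (c z - a + \<epsilon>) + (\<Sum>j\<in>P <+> P. l j * h j z)"
  proof (rule simplex_multipliers[where Z = "P \<times> P" and J = "P <+> P" and h = h and k = "\<lambda>z. c z - a + \<epsilon>"])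
    fix w :: "binseq \<times> binseq \<Rightarrow> real"
    assume w: "\<And>z. 0 \<le> w z" "\<And>z. z \<notin> P \<times> P \<Longrightarrow> w z = 0" "(\<Sum>z\<in>P \<times> P. w z) = 1"
      and inv: "\<And>j. j \<in> P <+> P \<Longrightarrow> (\<Sum>z\<in>P \<times> P. w z * h j z) = 0"
    obtain \<pi> where "\<pi> \<in> shift_plans" "integral\<^sup>L \<pi> c = (\<Sum>z\<in>P \<times> P. w z * c z)"
      by (rule finite_shift_plan[OF P(1,3) w _ _ c])
        (use inv[OF InlI] inv[OF InrI] in \<open>simp_all add: h_def d_def\<close>)
    then have "a \<le> (\<Sum>z\<in>P \<times> P. w z * c z)" using a by metis
    moreover have "(\<Sum>z\<in>P \<times> P. w z * (c z - a + \<epsilon>)) = (\<Sum>z\<in>P \<times> P. w z * c z) - (\<Sum>z\<in>P \<times> P. w z) * (a - \<epsilon>)"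
      by (simp add: algebra_simps sum.distrib sum_subtractf flip: sum_distrib_left)
    ultimately show "0 < (\<Sum>z\<in>P \<times> P. w z * (c z - a + \<epsilon>))" using w(3) \<epsilon> by simp
  qed (use P in auto)
  have sum_d: "(\<Sum>p\<in>P. m p * d p x) = m (shift x) - m x" if "x \<in> P" for x and m :: "binseq \<Rightarrow> real"
  proof -
    have "(\<Sum>p\<in>P. m p * d p x) = (\<Sum>p\<in>P. if shift x = p then m p else 0) - (\<Sum>p\<in>P. if x = p then m p else 0)"
      unfolding sum_subtractf[symmetric] by (intro sum.cong) (auto simp: d_def)
    then show ?thesis using that P by (simp add: image_subset_iff)
  qed
  show ?thesis
  proof (rule that)
    fix x y assume "x \<in> P" "y \<in> P"
    then show "a + (- l (Inl (shift x))) - (- l (Inl x)) + (- l (Inr (shift y))) - (- l (Inr y)) \<le> c (x, y) + \<epsilon>"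
      using l[of "(x, y)"] P sum_d[of x "\<lambda>p. l (Inl p)"] sum_d[of y "\<lambda>p. l (Inr p)"]
      by (simp add: sum.Plus h_def)
  qed
qed

section \<open>Periodic points\<close>

lemma finite_periodic_points:
  assumes "0 < N"
  shows "finite {x. (shift ^^ N) x = x}"
proof (rule finite_subset)
  show "{x. (shift ^^ N) x = x} \<subseteq> (\<lambda>A i. i mod N \<in> A) ` Pow {..<N}"
  proof clarify
    fix x assume x: "(shift ^^ N) x = x"
    have "x (i + N * m) = x i" for i m
    proof (induction m)
      case (Suc m)
      then show ?case using fun_cong[OF x, of "i + N * m"] by (simp add: shift_funpow add_ac)
    qed simp
    then have "x i = x (i mod N)" for i by (metis mod_mult_div_eq)
    then have "x = (\<lambda>i. i mod N \<in> {j. j < N \<and> x j})" using assms by auto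
    then show "x \<in> (\<lambda>A i. i mod N \<in> A) ` Pow {..<N}" by blast
  qed
qed simp

lemma funpow_shift_period:
  assumes "(shift ^^ k) x = x" "k dvd N"
  shows "(shift ^^ N) x = x"
proof -
  have "((shift ^^ k) ^^ m) x = x" for m by (induction m) (use assms in auto)
  then show ?thesis using assms(2) by (auto simp: funpow_mult elim!: dvdE) 
qed

lemma birkhoff_sum_coboundary:
  "birkhoff_sum (\<lambda>x. \<phi> (shift x) - \<phi> x) k x = \<phi> ((shift ^^ k) x) - \<phi> x"
  using sum_lessThan_telescope[of "\<lambda>j. \<phi> ((shift ^^ j) x)" k] by (simp add: birkhoff_sum_def)

text \<open>The last conclusion replaces the pointwise bound by sums over a closed orbit of
  \<open>y\<close>, where \<psi> telescopes away; the points \<open>u j\<close> stay arbitrary. So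
  neither potential nor the set of periodic points appears, and the conditions can pass to a limit
  in \<open>N\<close>.\<close>

lemma periodic_splitting:
  assumes N: "0 < N" and c: "c \<in> borel_measurable borel"
    and lip: "\<And>x x' y. c (x, y) - c (x', y) \<le> L * seq_dist \<theta> x x'"
    and a: "\<And>\<pi>. \<pi> \<in> shift_plans \<Longrightarrow> a \<le> integral\<^sup>L \<pi> c" and \<epsilon>: "0 < \<epsilon>"
  obtains f where "\<And>x y. f x - f y \<le> L * seq_dist \<theta> x y"
    "\<And>k x. k dvd N \<Longrightarrow> (shift ^^ k) x = x \<Longrightarrow> 0 \<le> birkhoff_sum f k x"
    "\<And>k y u. k dvd N \<Longrightarrow> (shift ^^ k) y = y \<Longrightarrow>
      (\<Sum>j<k. f (u j)) \<le> (\<Sum>j<k. c (u j, (shift ^^ j) y) - a + \<epsilon>)"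
proof -
  define P where "P = {x. (shift ^^ N) x = x}"
  have P: "finite P" unfolding P_def by (rule finite_periodic_points[OF N])
  have Pne: "P \<noteq> {}" by (auto simp: P_def shift_funpow intro: exI[of _ "\<lambda>_. True"])
  have shiftP: "shift ` P \<subseteq> P" by (auto simp: P_def simp flip: funpow_swap1)
  have orbit: "(shift ^^ j) x \<in> P" if "k dvd N" "(shift ^^ k) x = x" for j k x
    using shiftP funpow_shift_period[OF that(2,1)] by (induction j) (auto simp: P_def)
  obtain \<phi> \<psi> where pot: "\<And>x y. x \<in> P \<Longrightarrow> y \<in> P \<Longrightarrow>
      a + \<phi> (shift x) - \<phi> x + \<psi> (shift y) - \<psi> y \<le> c (x, y) + \<epsilon>"
    by (rule periodic_potentials[OF P Pne shiftP c a \<epsilon>]) auto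
  define g where "g x y = c (x, y) - a + \<epsilon> - (\<psi> (shift y) - \<psi> y)" for x y
  define f where "f x = Min (g x ` P)" for x
  have f_le: "f x \<le> g x y" if "y \<in> P" for x y
    using that P by (simp add: f_def)
  have f_attained: "\<exists>y\<in>P. f x = g x y" for x
  proof -
    have "Min (g x ` P) \<in> g x ` P" using P Pne by (intro Min_in) auto
    then show ?thesis by (auto simp: f_def)
  qed
  show ?thesis
  proof (rule that)
    show "f x - f x' \<le> L * seq_dist \<theta> x x'" for x x'
    proof -
      obtain y where y: "y \<in> P" "f x' = g x' y" using f_attained by blast
      then show ?thesis using f_le[OF y(1), of x] lip[of x y x'] by (simp add: g_def)
    qed
    show "0 \<le> birkhoff_sum f k x" if k: "k dvd N" "(shift ^^ k) x = x" for k x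
    proof -
      \<comment> \<open>The minimum \<open>f x\<close> is attained at some \<open>y\<close> in
        \<open>P\<close>, where \<open>pot\<close> is exactly this bound.\<close>
      have "\<phi> (shift x) - \<phi> x \<le> f x" if "x \<in> P" for x
        using f_attained[of x] pot[OF that] by (fastforce simp: g_def)
      then have "birkhoff_sum (\<lambda>x. \<phi> (shift x) - \<phi> x) k x \<le> birkhoff_sum f k x"
        unfolding birkhoff_sum_def using orbit[OF k]
        by (intro sum_mono) simp
      then show ?thesis by (simp add: birkhoff_sum_coboundary k)
    qed
    show "(\<Sum>j<k. f (u j)) \<le> (\<Sum>j<k. c (u j, (shift ^^ j) y) - a + \<epsilon>)"
      if k: "k dvd N" "(shift ^^ k) y = y" for k y u
    proof -
      have "(\<Sum>j<k. f (u j)) \<le> (\<Sum>j<k. g (u j) ((shift ^^ j) y))"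
        using orbit[OF k] by (intro sum_mono f_le)
      also have "\<dots> = (\<Sum>j<k. c (u j, (shift ^^ j) y) - a + \<epsilon>) - birkhoff_sum (\<lambda>y. \<psi> (shift y) - \<psi> y) k y"
        by (simp add: g_def birkhoff_sum_def sum_subtractf)
      finally show ?thesis by (simp only: birkhoff_sum_coboundary k)
    qed
  qed
qed

section \<open>Passage to all periods\<close>

text \<open>The set \<open>F n\<close> in the proof imposes the conditions for the periods up to \<open>Suc n\<close> only, with
  error \<open>1 / Suc n\<close>; the previous lemma for the period \<open>fact (Suc n)\<close> makes it nonempty.\<close>

lemma invariant_splitting:
  assumes \<theta>: "0 < \<theta>" "\<theta> < 1" and L: "0 \<le> L" and c: "c \<in> borel_measurable borel"
    and lip: "\<And>x x' y. c (x, y) - c (x', y) \<le> L * seq_dist \<theta> x x'" and B: "\<And>z. c z \<le> B"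
    and a: "\<And>\<pi>. \<pi> \<in> shift_plans \<Longrightarrow> a \<le> integral\<^sup>L \<pi> c"
  obtains f where "\<And>x. - L \<le> f x" "\<And>x. f x \<le> B - a + 1" "\<And>x y. f x - f y \<le> L * seq_dist \<theta> x y"
    "\<And>k x. 0 < k \<Longrightarrow> (shift ^^ k) x = x \<Longrightarrow> 0 \<le> birkhoff_sum f k x"
    "\<And>k y u. 0 < k \<Longrightarrow> (shift ^^ k) y = y \<Longrightarrow>
      (\<Sum>j<k. f (u j)) \<le> (\<Sum>j<k. c (u j, (shift ^^ j) y) - a)"
proof -
  define K where "K = {f :: binseq \<Rightarrow> real. \<forall>x. f x \<in> {- L..B - a + 1}}"
  define F where "F n = {f :: binseq \<Rightarrow> real. (\<forall>x y. f x - f y \<le> L * seq_dist \<theta> x y) \<and>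
    (\<forall>k x. k \<in> {0<..Suc n} \<and> (shift ^^ k) x = x \<longrightarrow> 0 \<le> birkhoff_sum f k x) \<and>
    (\<forall>k y u. k \<in> {0<..Suc n} \<and> (shift ^^ k) y = y \<longrightarrow>
      (\<Sum>j<k. f (u j)) \<le> (\<Sum>j<k. c (u j, (shift ^^ j) y) - a + inverse (real (Suc n))))}" for n
  have K: "compact K"
    using compact_box_fun[of "\<lambda>_. - L" "\<lambda>_. B - a + 1"] by (simp add: K_def)
  \<comment> \<open>Each condition involves only finitely many values of \<open>f\<close>, so it is
    closed under pointwise convergence.\<close>
  have cl: "closed (F n)" for n
    unfolding F_def birkhoff_sum_def
    by (intro closed_Collect_conj closed_Collect_all closed_Collect_imp closed_Collect_le open_Collect_const
        continuous_intros continuous_on_subset[OF continuous_on_product_coordinates]) auto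
  have ne: "K \<inter> F n \<noteq> {}" for n
  proof -
    obtain f where f: "\<And>x y. f x - f y \<le> L * seq_dist \<theta> x y"
      "\<And>k x. k dvd fact (Suc n) \<Longrightarrow> (shift ^^ k) x = x \<Longrightarrow> 0 \<le> birkhoff_sum f k x"
      "\<And>k y u. k dvd fact (Suc n) \<Longrightarrow> (shift ^^ k) y = y \<Longrightarrow>
        (\<Sum>j<k. f (u j)) \<le> (\<Sum>j<k. c (u j, (shift ^^ j) y) - a + inverse (real (Suc n)))"
      by (rule periodic_splitting[OF fact_gt_zero c lip a, of "inverse (real (Suc n))" "Suc n"]) auto
    have dvd: "k dvd fact (Suc n)" if "k \<in> {0<..Suc n}" for k :: nat
      using that by (intro dvd_fact) auto
    \<comment> \<open>A fixed point: the conditions for \<open>k = 1\<close> at \<open>z\<close>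
      give \<open>0 \<le> f z\<close> and the upper bound on \<open>f x\<close>; the Lipschitz bound
      then gives \<open>- L \<le> f x\<close>.\<close>
    define z :: binseq where "z = (\<lambda>_. False)"
    have z: "shift z = z" by (simp add: z_def shift_def)
    have "f x \<in> {- L..B - a + 1}" for x
    proof -
      have "0 \<le> f z" using f(2)[of 1 z] z by (simp add: birkhoff_sum_def)
      moreover have "f z - f x \<le> L * 1"
        using L seq_dist_le_1[OF \<theta>] by (intro order.trans[OF f(1)] mult_left_mono)
      moreover have "f x \<le> c (x, z) - a + inverse (real (Suc n))" using f(3)[of 1 z "\<lambda>_. x"] z by simp
      moreover have "inverse (real (Suc n)) \<le> 1" by (simp add: inverse_le_1_iff)
      ultimately show ?thesis using B[of "(x, z)"] by simp
    qed
    moreover have "f \<in> F n" using f dvd unfolding F_def by blast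
    ultimately show ?thesis by (auto simp: K_def)
  qed
  have dec: "F n \<subseteq> F m" if "m \<le> n" for m n
  proof
    fix f assume f: "f \<in> F n"
    have "(\<Sum>j<k. f (u j)) \<le> (\<Sum>j<k. c (u j, (shift ^^ j) y) - a + inverse (real (Suc m)))"
      if "k \<in> {0<..Suc m}" "(shift ^^ k) y = y" for k y u
    proof -
      have "k \<in> {0<..Suc n}" using that \<open>m \<le> n\<close> by auto
      then have "(\<Sum>j<k. f (u j)) \<le> (\<Sum>j<k. c (u j, (shift ^^ j) y) - a + inverse (real (Suc n)))"
        using f that(2) unfolding F_def by blast
      also have "\<dots> \<le> (\<Sum>j<k. c (u j, (shift ^^ j) y) - a + inverse (real (Suc m)))"
        using \<open>m \<le> n\<close> by (intro sum_mono add_left_mono le_imp_inverse_le) auto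
      finally show ?thesis .
    qed
    then show "f \<in> F m" using f \<open>m \<le> n\<close> by (auto simp: F_def)
  qed
  obtain f where f: "f \<in> K" "\<And>n. f \<in> F n"
    by (rule compact_decreasing_Inter[where F = F, OF K cl ne dec]) (assumption, rule that)
  show ?thesis
  proof (rule that)
    show "- L \<le> f x" "f x \<le> B - a + 1" for x using f(1) by (auto simp: K_def)
    show "f x - f y \<le> L * seq_dist \<theta> x y" for x y using f(2)[of 0] by (simp add: F_def)
    show "0 \<le> birkhoff_sum f k x" if "0 < k" "(shift ^^ k) x = x" for k x
      using f(2)[of k] that by (simp add: F_def)
    show "(\<Sum>j<k. f (u j)) \<le> (\<Sum>j<k. c (u j, (shift ^^ j) y) - a)"
      if k: "0 < k" "(shift ^^ k) y = y" for k y u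
    proof (rule field_le_epsilon)
      fix e :: real assume "0 < e"
      then obtain n where n: "inverse (real (Suc n)) < e / real k"
        using reals_Archimedean[of "e / real k"] k by auto
      \<comment> \<open>The index \<open>n + k\<close> makes the period \<open>k\<close> admissible
        and keeps the error below \<open>e / k\<close>.\<close>
      have "k \<in> {0<..Suc (n + k)}" using k by auto
      then have "(\<Sum>j<k. f (u j)) \<le> (\<Sum>j<k. c (u j, (shift ^^ j) y) - a + inverse (real (Suc (n + k))))"
        using f(2)[of "n + k"] k(2) unfolding F_def by blast
      also have "\<dots> \<le> (\<Sum>j<k. c (u j, (shift ^^ j) y) - a + e / real k)"
        using n by (intro sum_mono add_left_mono order.trans[OF le_imp_inverse_le less_imp_le[OF n]]) auto
      also have "\<dots> = (\<Sum>j<k. c (u j, (shift ^^ j) y) - a) + e"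
        using k by (simp add: sum.distrib)
      finally show "(\<Sum>j<k. f (u j)) \<le> (\<Sum>j<k. c (u j, (shift ^^ j) y) - a) + e" .
    qed
  qed
qed

section \<open>The conjugate function and the two coboundaries\<close>

theorem proposition13:
  fixes \<theta> \<alpha> :: real and c :: "binseq \<times> binseq \<Rightarrow> real"
  assumes "0 < \<theta>" and "\<theta> < 1"
    and "Lipschitz_continuous_map (sum_metric (seq_metric \<theta>) (seq_metric \<theta>)) euclidean_metric c"
    and "\<alpha> = (INF \<pi>\<in>shift_plans. integral\<^sup>L \<pi> c)"
  shows "\<exists>\<phi> \<psi>. Lipschitz_continuous_map (seq_metric \<theta>) euclidean_metric \<phi> \<and>
               Lipschitz_continuous_map (seq_metric \<theta>) euclidean_metric \<psi> \<and>
               (\<forall>x y. \<alpha> + \<phi> (shift x) - \<phi> x + \<psi> (shift y) - \<psi> y \<le> c (x, y))"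
proof -
  note \<theta> = assms(1,2)
  have "continuous_map euclidean euclidean c"
    using Lipschitz_continuous_imp_continuous_map[OF assms(3)]
    by (simp add: mtopology_of_sum_seq_metric[OF \<theta>])
  then have c: "c \<in> borel_measurable borel" by (auto intro: borel_measurable_continuous_onI)
  obtain L where L: "0 < L" and lip: "\<And>z w. \<bar>c z - c w\<bar> \<le> L * (seq_dist \<theta> (fst z) (fst w) + seq_dist \<theta> (snd z) (snd w))"
    using assms(3) unfolding Lipschitz_continuous_map_pos
    by (auto simp: mspace_seq_metric[OF \<theta>] mdist_seq_metric[OF \<theta>] dist_real_def)
  have lip1: "c (x, y) - c (x', y) \<le> L * seq_dist \<theta> x x'"
    and lip2: "c (x, y) - c (x, y') \<le> L * seq_dist \<theta> y y'" for x x' y y'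
    using lip[of "(x, y)" "(x', y)"] lip[of "(x, y)" "(x, y')"]
    by (simp_all add: seq_dist_def[of \<theta> x x] seq_dist_def[of \<theta> y y])
  define B where "B = \<bar>c ((\<lambda>_. False), (\<lambda>_. False))\<bar> + 2 * L"
  have cB: "\<bar>c z\<bar> \<le> B" for z
  proof -
    let ?o = "((\<lambda>_. False), (\<lambda>_. False)) :: binseq \<times> binseq"
    have "\<bar>c z - c ?o\<bar> \<le> L * (1 + 1)"
      using L by (intro order.trans[OF lip] mult_left_mono add_mono seq_dist_le_1[OF \<theta>]) auto
    then show ?thesis by (simp add: B_def)
  qed
  \<comment> \<open>A real \<open>INF\<close> is a lower bound only if the set of values is bounded
    below.\<close>
  have bound: "- B \<le> integral\<^sup>L \<pi> c" if "\<pi> \<in> shift_plans" for \<pi>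
  proof -
    interpret prob_space \<pi> using that by (simp add: shift_plans_def)
    have "sets \<pi> = sets borel" using that by (simp add: shift_plans_def)
    then have "c \<in> borel_measurable \<pi>" using c measurable_cong_sets by blast
    then have "integrable \<pi> c" using cB by (intro integrable_const_bound[of _ B]) auto
    then show ?thesis using cB by (intro integral_ge_const) (auto simp: abs_le_iff minus_le_iff)
  qed
  have \<alpha>: "\<alpha> \<le> integral\<^sup>L \<pi> c" if "\<pi> \<in> shift_plans" for \<pi>
    unfolding assms(4) using bound that by (intro cINF_lower bdd_belowI2) auto
  obtain f where f: "\<And>x. - L \<le> f x" "\<And>x. f x \<le> B - \<alpha> + 1" "\<And>x y. f x - f y \<le> L * seq_dist \<theta> x y"
    "\<And>k x. 0 < k \<Longrightarrow> (shift ^^ k) x = x \<Longrightarrow> 0 \<le> birkhoff_sum f k x"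
    "\<And>k y u. 0 < k \<Longrightarrow> (shift ^^ k) y = y \<Longrightarrow>
      (\<Sum>j<k. f (u j)) \<le> (\<Sum>j<k. c (u j, (shift ^^ j) y) - \<alpha>)"
    by (rule invariant_splitting[OF \<theta> less_imp_le[OF L] c lip1 _ \<alpha>, of B]) (use cB in \<open>auto simp: abs_le_iff\<close>)
  \<comment> \<open>The largest \<open>g\<close> with
    \<open>f x + g y \<le> c (x, y) - \<alpha>\<close>; it inherits the Lipschitz constant of
    \<open>c\<close> in \<open>y\<close>.\<close>
  define g where "g y = (INF x. c (x, y) - \<alpha> - f x)" for y
  have bdd: "bdd_below (range (\<lambda>x. c (x, y) - \<alpha> - f x))" for y
    \<comment> \<open>In this bound \<alpha> cancels against the one in the upper bound for
      \<open>f\<close>.\<close>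
    using cB f(2) by (intro bdd_belowI2[of _ "- 2 * B - 1"]) (smt (verit))
  have g_le: "g y \<le> c (x, y) - \<alpha> - f x" for x y
    unfolding g_def by (rule cINF_lower[OF bdd]) simp
  have g_lip: "g y - g y' \<le> L * seq_dist \<theta> y y'" for y y'
  proof -
    have "g y - L * seq_dist \<theta> y y' \<le> g y'"
      unfolding g_def[of y']
    proof (rule cINF_greatest)
      show "g y - L * seq_dist \<theta> y y' \<le> c (x, y') - \<alpha> - f x" for x
        using g_le[of y x] lip2[of x y y'] by simp
    qed simp
    then show ?thesis by simp
  qed
  have g_per: "0 \<le> birkhoff_sum g k y" if k: "0 < k" "(shift ^^ k) y = y" for k y
  proof (rule field_le_epsilon)
    fix e :: real assume "0 < e"
    then have e: "0 < e / real k" using k by simp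
    \<comment> \<open>Near-minimisers are chosen separately at each orbit point and need not form an
      orbit; hence the arbitrary \<open>u\<close> in the last property of \<open>f\<close>.\<close>
    have "\<exists>x. c (x, (shift ^^ j) y) - \<alpha> - f x < g ((shift ^^ j) y) + e / real k" for j
      using cInf_lessD[of "range (\<lambda>x. c (x, (shift ^^ j) y) - \<alpha> - f x)" "g ((shift ^^ j) y) + e / real k"] e
      by (auto simp: g_def)
    then obtain u where u: "\<And>j. c (u j, (shift ^^ j) y) - \<alpha> - f (u j) < g ((shift ^^ j) y) + e / real k"
      by metis
    have "0 \<le> (\<Sum>j<k. c (u j, (shift ^^ j) y) - \<alpha> - f (u j))"
      using f(5)[OF k, of u] by (simp add: sum_subtractf)
    also have "\<dots> \<le> (\<Sum>j<k. g ((shift ^^ j) y) + e / real k)"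
      using u by (intro sum_mono less_imp_le)
    also have "\<dots> = birkhoff_sum g k y + e" using k by (simp add: birkhoff_sum_def sum.distrib)
    finally show "0 \<le> birkhoff_sum g k y + e" .
  qed
  obtain \<phi> where \<phi>: "Lipschitz_continuous_map (seq_metric \<theta>) euclidean_metric \<phi>"
    "\<And>x. \<phi> (shift x) - \<phi> x \<le> f x"
    using Lipschitz_coboundary_le[OF \<theta> less_imp_le[OF L] f(3,4)] by blast
  obtain \<psi> where \<psi>: "Lipschitz_continuous_map (seq_metric \<theta>) euclidean_metric \<psi>"
    "\<And>y. \<psi> (shift y) - \<psi> y \<le> g y"
    using Lipschitz_coboundary_le[OF \<theta> less_imp_le[OF L] g_lip g_per] by blast
  have "\<alpha> + \<phi> (shift x) - \<phi> x + \<psi> (shift y) - \<psi> y \<le> c (x, y)" for x y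
    using \<phi>(2)[of x] \<psi>(2)[of y] g_le[of y x] by linarith
  then show ?thesis using \<phi>(1) \<psi>(1) by blast
qed

end
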